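(* Let $(G,\upsilon,\varepsilon)$ be a weighted multigraph with at least one nonloop edge and let $\lambda_n$ be its largest weighted Laplacian eigenvalue. Then for any nonempty independent set $S$, we have $$\upsilon(S)\le\upsilon(V)\,\frac{\lambda_n-\frac{d_{(G,\varepsilon)}(S)}{\upsilon(S)}}{\lambda_n}.$$
   Context: A graph is a finite multigraph with vertex set $V$ and edge set $E$ (loops and multiple edges allowed). A weighted multigraph $(G,\upsilon,\varepsilon)$ is a graph $G$ with vertex weights $\upsilon:V\to\mathbb R_{>0}$ and edge weights $\varepsilon:E\to\mathbb R_{>0}$. For $u,v\in V$, $\varepsilon(u,v)$ is the total edge weight between $u$ and $v$, with loops counted twice, and the degree of $u$ is $d_{(G,\varepsilon)}(u)=\sum_{v\in V}\varepsilon(u,v)$. Both $\upsilon$ and $d_{(G,\varepsilon)}$ are extended to measures on $V$: for $S\subseteq V$, $\upsilon(S)=\sum_{v\in S}\upsilon(v)$ and $d_{(G,\varepsilon)}(S)=\sum_{v\in S}d_{(G,\varepsilon)}(v)$. The combinatorial Laplacian is the $V\times V$ matrix $L_{(G,\varepsilon)}=D_{(G,\varepsilon)}-A_{(G,\varepsilon)}$, where $A_{(G,\varepsilon)}=(\varepsilon(u,v))_{u,v\in V}$ and $D_{(G,\varepsilon)}$ is the diagonal matrix with entries $d_{(G,\varepsilon)}(v)$. The weighted Laplacian is $L_{(G,\upsilon,\varepsilon)}=W_\upsilon^{-1}L_{(G,\varepsilon)}$, where $W_\upsilon$ is the diagonal matrix with entries $\upsilon(v)$; it is self-adjoint for the inner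 product $\langle f,g\rangle=\sum_{v\in V}f(v)g(v)\upsilon(v)$ on functions $V\to\mathbb R$, so its eigenvalues are real. An independent set is a subset $S\subseteq V$ with no two vertices of $S$ joined by an edge. *)

theory Defs
  imports "HOL-Analysis.Analysis" "HOL-Library.Uprod"
begin

text \<open>
  The vertex set is the finite type \<open>'v\<close>, so that \<open>V \<times> V\<close> matrices have type \<open>real^'v^'v\<close>.
  Edges are abstract objects, so several edges may have the same endpoints; the edge \<open>e\<close> is a
  loop when \<open>ends e = Upair v v\<close>.
\<close>

definition weighted_multigraph ::
    "'e set \<Rightarrow> ('e \<Rightarrow> 'v::finite uprod) \<Rightarrow> ('v \<Rightarrow> real) \<Rightarrow> ('e \<Rightarrow> real) \<Rightarrow> bool" where
  "weighted_multigraph E ends \<upsilon> \<epsilon> \<longleftrightarrow>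
     finite E \<and> (\<forall>v. 0 < \<upsilon> v) \<and> (\<forall>e\<in>E. 0 < \<epsilon> e)"

definition total_weight ::
    "'e set \<Rightarrow> ('e \<Rightarrow> 'v uprod) \<Rightarrow> ('e \<Rightarrow> real) \<Rightarrow> 'v \<Rightarrow> 'v \<Rightarrow> real" where
  "total_weight E ends \<epsilon> u v =
     (if u = v then 2 else 1) * (\<Sum>e | e \<in> E \<and> ends e = Upair u v. \<epsilon> e)"

definition weighted_degree ::
    "'e set \<Rightarrow> ('e \<Rightarrow> 'v::finite uprod) \<Rightarrow> ('e \<Rightarrow> real) \<Rightarrow> 'v \<Rightarrow> real" where
  "weighted_degree E ends \<epsilon> u = (\<Sum>v\<in>UNIV. total_weight E ends \<epsilon> u v)"

definition diagonal_matrix :: "('v::finite \<Rightarrow> real) \<Rightarrow> real^'v^'v" where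
  "diagonal_matrix f = (\<chi> u v. if u = v then f u else 0)"

definition adjacency_matrix ::
    "'e set \<Rightarrow> ('e \<Rightarrow> 'v::finite uprod) \<Rightarrow> ('e \<Rightarrow> real) \<Rightarrow> real^'v^'v" where
  "adjacency_matrix E ends \<epsilon> = (\<chi> u v. total_weight E ends \<epsilon> u v)"

definition combinatorial_Laplacian ::
    "'e set \<Rightarrow> ('e \<Rightarrow> 'v::finite uprod) \<Rightarrow> ('e \<Rightarrow> real) \<Rightarrow> real^'v^'v" where
  "combinatorial_Laplacian E ends \<epsilon> =
     diagonal_matrix (weighted_degree E ends \<epsilon>) - adjacency_matrix E ends \<epsilon>"

definition weighted_Laplacian ::
    "'e set \<Rightarrow> ('e \<Rightarrow> 'v::finite uprod) \<Rightarrow> ('v \<Rightarrow> real) \<Rightarrow> ('e \<Rightarrow> real) \<Rightarrow> real^'v^'v" where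
  "weighted_Laplacian E ends \<upsilon> \<epsilon> =
     matrix_inv (diagonal_matrix \<upsilon>) ** combinatorial_Laplacian E ends \<epsilon>"

definition eigenvalue :: "real^'n^'n \<Rightarrow> real \<Rightarrow> bool" where
  "eigenvalue M \<mu> \<longleftrightarrow> (\<exists>x. x \<noteq> 0 \<and> M *v x = \<mu> *\<^sub>R x)"

text \<open>
  The set of real eigenvalues is always finite; it is nonempty for a weighted Laplacian, which is
  self-adjoint with respect to the inner product weighted by \<open>\<upsilon>\<close>.
\<close>

definition largest_eigenvalue :: "real^'n^'n \<Rightarrow> real" where
  "largest_eigenvalue M = Max {\<mu>. eigenvalue M \<mu>}"

text \<open>
  The case \<open>u = v\<close> is included: a vertex carrying a loop lies in no independent set. The loop
  contributes to the degree but cancels in the Laplacian, so the ratio bound fails otherwise.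
\<close>

definition independent_set :: "'e set \<Rightarrow> ('e \<Rightarrow> 'v uprod) \<Rightarrow> 'v set \<Rightarrow> bool" where
  "independent_set E ends S \<longleftrightarrow> (\<forall>u\<in>S. \<forall>v\<in>S. \<not> (\<exists>e\<in>E. ends e = Upair u v))"

end

theory Submission
  imports Defs
begin

text \<open>
  The proof is the Rayleigh principle applied to one test function. Write \<open>C\<close> for the combinatorial
  Laplacian, \<open>Q f = f \<bullet> (C *v f)\<close> for its quadratic form and \<open>N f = (\<Sum>v. \<upsilon> v * (f v)\<^sup>2)\<close> for the
  weighted square norm. The largest weighted eigenvalue \<open>\<lambda>\<close> satisfies \<open>Q f \<le> \<lambda> * N f\<close> for all \<open>f\<close>
  (\<open>Laplacian_form_le\<close>). Constants lie in the kernel of the symmetric matrix \<open>C\<close>, so shifting \<open>f\<close>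
  by a constant does not change \<open>Q\<close>, while the shift that makes \<open>f\<close> have weighted mean zero
  minimizes \<open>N\<close>. For the indicator of \<open>S\<close> this gives
  \<open>Q 1\<^sub>S \<le> \<lambda> * \<upsilon>(S) * (1 - \<upsilon>(S) / \<upsilon>(V))\<close>. The left-hand side is the weight of the
  edges leaving \<open>S\<close>, which for an independent set is the whole degree \<open>d(S)\<close>, and solving for
  \<open>\<upsilon>(S)\<close> is the claim. The division by \<open>\<lambda>\<close> is legitimate because the indicator of an endpoint
  of a nonloop edge has \<open>Q > 0\<close>.

  The Rayleigh principle itself is proved for self-adjoint operators on Euclidean spaces. The
  maximum of the quadratic form on the unit sphere is an eigenvalue, and eigenvectors of distinct
  eigenvalues are orthogonal, so that there are finitely many eigenvalues and the maximum in the
  definition of \<open>\<lambda>\<close> is taken over a finite set. The weighted Laplacian is not symmetric for the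
  standard inner product, but the substitution \<open>y v = sqrt (\<upsilon> v) * x v\<close> turns it into an operator
  that is.
\<close>

section \<open>Self-adjoint operators on Euclidean spaces\<close>

text \<open>
  A choice of one eigenvector for each eigenvalue is an injective family of pairwise orthogonal
  nonzero vectors, and such a family is linearly independent.
\<close>

lemma finite_eigenvalues_selfadjoint:
  fixes f :: "'a::euclidean_space \<Rightarrow> 'a"
  assumes adj: "\<And>x y. f x \<bullet> y = x \<bullet> f y"
  shows "finite {\<mu>. \<exists>x. x \<noteq> 0 \<and> f x = \<mu> *\<^sub>R x}" (is "finite ?M")
proof -
  define g where "g = (\<lambda>\<mu>. SOME x. x \<noteq> 0 \<and> f x = \<mu> *\<^sub>R x)"
  have g: "g \<mu> \<noteq> 0 \<and> f (g \<mu>) = \<mu> *\<^sub>R g \<mu>" if "\<mu> \<in> ?M" for \<mu>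
    unfolding g_def by (rule someI_ex) (use that in blast)
  have orth: "g \<mu> \<bullet> g \<nu> = 0" if "\<mu> \<in> ?M" "\<nu> \<in> ?M" "\<mu> \<noteq> \<nu>" for \<mu> \<nu>
  proof -
    have "\<mu> * (g \<mu> \<bullet> g \<nu>) = \<nu> * (g \<mu> \<bullet> g \<nu>)"
      using adj[of "g \<mu>" "g \<nu>"] g[OF that(1)] g[OF that(2)] by simp
    with that(3) show ?thesis by simp
  qed
  have inj: "inj_on g ?M"
  proof (rule inj_onI)
    fix \<mu> \<nu> assume "\<mu> \<in> ?M" "\<nu> \<in> ?M" "g \<mu> = g \<nu>"
    then show "\<mu> = \<nu>" using orth[of \<mu> \<nu>] g[of \<nu>] by (metis inner_eq_zero_iff)
  qed
  have "pairwise orthogonal (g ` ?M)"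
    unfolding pairwise_image orthogonal_def by (rule pairwiseI) (use orth in blast)
  moreover have "0 \<notin> g ` ?M" using g by force
  ultimately have "independent (g ` ?M)"
    by (rule pairwise_orthogonal_independent)
  then have "finite (g ` ?M)" by (rule independent_imp_finite)
  then show ?thesis using inj by (rule finite_imageD)
qed

text \<open>
  The quadratic form attains its maximum \<open>\<mu>\<close> on the unit sphere at some \<open>z\<close>. Then
  \<open>\<mu> * (x \<bullet> x) - x \<bullet> f x\<close> is a nonnegative quadratic form that vanishes at \<open>z\<close>; were the residual
  \<open>r = \<mu> z - f z\<close> nonzero, moving slightly from \<open>z\<close> in the direction \<open>-r\<close> would make it negative.
\<close>

lemma selfadjoint_maximal_eigenvalue:
  fixes f :: "'a::euclidean_space \<Rightarrow> 'a"
  assumes lin: "linear f" and adj: "\<And>x y. f x \<bullet> y = x \<bullet> f y"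
  obtains \<mu> z where "z \<noteq> 0" "f z = \<mu> *\<^sub>R z" "\<And>x. x \<bullet> f x \<le> \<mu> * (x \<bullet> x)"
proof -
  have "continuous_on (sphere (0::'a) 1) (\<lambda>x. x \<bullet> f x)"
    by (rule continuous_on_inner[OF continuous_on_id linear_continuous_on])
      (use lin in \<open>simp add: linear_conv_bounded_linear\<close>)
  moreover have "sphere (0::'a) 1 \<noteq> {}" by simp
  ultimately have "\<exists>z\<in>sphere 0 1. \<forall>x\<in>sphere 0 1. x \<bullet> f x \<le> z \<bullet> f z"
    by (rule continuous_attains_sup[OF compact_sphere, rotated])
  then obtain z where z: "norm z = 1"
    and max: "\<And>x. norm x = 1 \<Longrightarrow> x \<bullet> f x \<le> z \<bullet> f z"
    unfolding mem_sphere_0 Bex_def Ball_def by blast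
  define \<mu> where "\<mu> = z \<bullet> f z"
  have bound: "x \<bullet> f x \<le> \<mu> * (x \<bullet> x)" for x
  proof (cases "x = 0")
    case False
    have "(x /\<^sub>R norm x) \<bullet> f (x /\<^sub>R norm x) \<le> \<mu>"
      unfolding \<mu>_def by (rule max) (use False in simp)
    then have "(x \<bullet> f x) / (norm x)\<^sup>2 \<le> \<mu>"
      by (simp add: linear_cmul[OF lin] power2_eq_square divide_inverse mult.commute mult.left_commute)
    then show ?thesis
      using False by (simp add: field_simps power2_norm_eq_inner)
  qed simp
  define r where "r = \<mu> *\<^sub>R z - f z"
  define K where "K = \<mu> * (r \<bullet> r) - r \<bullet> f r"
  have zz: "z \<bullet> z = 1" using z by (simp add: norm_eq_1)
  have K: "0 \<le> K" using bound[of r] by (simp add: K_def)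
  have quad: "0 \<le> 2 * t * (r \<bullet> r) + t\<^sup>2 * K" for t
  proof -
    have cross: "z \<bullet> f r = f z \<bullet> r" "r \<bullet> f z = f z \<bullet> r"
      using adj[of z r] by (simp_all add: inner_commute)
    have rr: "r \<bullet> r = \<mu> * (z \<bullet> r) - f z \<bullet> r"
      by (simp add: r_def inner_diff_left inner_commute)
    have "(z + t *\<^sub>R r) \<bullet> f (z + t *\<^sub>R r) = \<mu> + 2 * t * (f z \<bullet> r) + t\<^sup>2 * (r \<bullet> f r)"
      by (simp add: linear_add[OF lin] linear_cmul[OF lin] inner_add_left inner_add_right
          cross \<mu>_def power2_eq_square algebra_simps)
    moreover have "(z + t *\<^sub>R r) \<bullet> (z + t *\<^sub>R r) = 1 + 2 * t * (z \<bullet> r) + t\<^sup>2 * (r \<bullet> r)"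
      by (simp add: inner_add_left inner_add_right zz inner_commute[of r z]
          power2_eq_square algebra_simps)
    ultimately have "\<mu> + 2 * t * (f z \<bullet> r) + t\<^sup>2 * (r \<bullet> f r)
        \<le> \<mu> * (1 + 2 * t * (z \<bullet> r) + t\<^sup>2 * (r \<bullet> r))"
      using bound[of "z + t *\<^sub>R r"] by simp
    then show ?thesis
      unfolding K_def by (subst rr) (simp add: algebra_simps)
  qed
  have "r = 0"
  proof (rule ccontr)
    assume "r \<noteq> 0"
    then have p: "0 < r \<bullet> r" by simp
    \<comment> \<open>This \<open>t\<close> minimizes the quadratic polynomial with \<open>K + 1\<close> in place of \<open>K\<close>, which may be 0.\<close>
    define t where "t = - (r \<bullet> r) / (K + 1)"
    have "t * (K + 1) = - (r \<bullet> r)" using K by (simp add: t_def)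
    then have "2 * t * (r \<bullet> r) + t\<^sup>2 * K = - (t\<^sup>2 * (K + 2))"
      by (simp add: power2_eq_square) algebra
    moreover have "0 < t\<^sup>2 * (K + 2)" using p K by (simp add: t_def)
    ultimately show False using quad[of t] by simp
  qed
  then have "f z = \<mu> *\<^sub>R z" by (simp add: r_def)
  moreover have "z \<noteq> 0" using z by auto
  ultimately show thesis using that bound by blast
qed

section \<open>The Rayleigh principle for the weighted Laplacian\<close>

lemma matrix_inv_unique:
  assumes "A ** B = mat 1" "B ** A = mat 1"
  shows "matrix_inv A = B"
proof -
  have "matrix_inv A ** A = mat 1"
    unfolding matrix_inv_def by (rule someI2[of _ B]) (use assms in auto)
  then show ?thesis
    by (metis assms(1) matrix_mul_assoc matrix_mul_lid matrix_mul_rid)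
qed

lemma matrix_inv_diagonal:
  fixes f :: "'v::finite \<Rightarrow> real"
  assumes "\<And>v. f v \<noteq> 0"
  shows "matrix_inv (diagonal_matrix f) = diagonal_matrix (\<lambda>v. inverse (f v))"
proof (rule matrix_inv_unique)
  show "diagonal_matrix f ** diagonal_matrix (\<lambda>v. inverse (f v)) = mat 1"
    "diagonal_matrix (\<lambda>v. inverse (f v)) ** diagonal_matrix f = mat 1"
    using assms
    by (auto simp: vec_eq_iff matrix_matrix_mult_def diagonal_matrix_def mat_def
        if_distrib[of "\<lambda>x. x * _"] if_distrib[of "\<lambda>x. _ * x"] sum.delta cong: if_cong)
qed

lemma diagonal_matrix_vector_mult: "(diagonal_matrix f *v x) $ u = f u * x $ u"
  by (simp add: diagonal_matrix_def matrix_vector_mult_def if_distrib[of "\<lambda>y. y * _"] sum.delta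
      cong: if_cong)

lemma weighted_Laplacian_mult:
  assumes "\<And>v. 0 < \<upsilon> v"
  shows "(weighted_Laplacian E ends \<upsilon> \<epsilon> *v x) $ u
       = (combinatorial_Laplacian E ends \<epsilon> *v x) $ u / \<upsilon> u"
proof -
  have "\<upsilon> v \<noteq> 0" for v using assms[of v] by simp
  then show ?thesis
    by (simp add: weighted_Laplacian_def matrix_inv_diagonal matrix_vector_mul_assoc[symmetric]
        diagonal_matrix_vector_mult field_simps)
qed

lemma total_weight_commute: "total_weight E ends \<epsilon> u v = total_weight E ends \<epsilon> v u"
proof -
  have "Upair u v = Upair v u" by simp
  then show ?thesis unfolding total_weight_def by (simp only: eq_commute[of u v])
qed

lemma combinatorial_Laplacian_selfadjoint:
  "(combinatorial_Laplacian E ends \<epsilon> *v x) \<bullet> y = x \<bullet> (combinatorial_Laplacian E ends \<epsilon> *v y)"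
proof -
  have "transpose (combinatorial_Laplacian E ends \<epsilon>) = combinatorial_Laplacian E ends \<epsilon>"
    by (simp add: vec_eq_iff transpose_def combinatorial_Laplacian_def diagonal_matrix_def
        adjacency_matrix_def total_weight_commute)
  then show ?thesis
    by (metis dot_lmul_matrix transpose_matrix_vector)
qed

text \<open>
  With \<open>W\<close> the diagonal matrix of \<open>\<upsilon>\<close> and \<open>R\<close> its square root, \<open>W\<^sup>-\<^sup>1 C\<close> is similar to
  the symmetric matrix \<open>R\<^sup>-\<^sup>1 C R\<^sup>-\<^sup>1\<close>, and the Rayleigh bound for the latter at \<open>R x\<close> is the
  weighted bound at \<open>x\<close>.
\<close>

lemma Laplacian_form_le:
  fixes x :: "real^'v::finite"
  assumes pos: "\<And>v. 0 < \<upsilon> v"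
  shows "x \<bullet> (combinatorial_Laplacian E ends \<epsilon> *v x)
    \<le> largest_eigenvalue (weighted_Laplacian E ends \<upsilon> \<epsilon>) * (\<Sum>v\<in>UNIV. \<upsilon> v * (x $ v)\<^sup>2)"
proof -
  define C where "C = combinatorial_Laplacian E ends \<epsilon>"
  define L where "L = weighted_Laplacian E ends \<upsilon> \<epsilon>"
  define R where "R = diagonal_matrix (\<lambda>v. sqrt (\<upsilon> v))"
  define R' where "R' = diagonal_matrix (\<lambda>v. inverse (sqrt (\<upsilon> v)))"
  define T where "T = (\<lambda>y. R' *v (C *v (R' *v y)))"
  have nz: "sqrt (\<upsilon> v) \<noteq> 0" for v using pos[of v] by simp
  have RR': "R *v (R' *v y) = y" and R'R: "R' *v (R *v y) = y" for y
    using nz by (simp_all add: vec_eq_iff R_def R'_def diagonal_matrix_vector_mult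
        mult.assoc[symmetric] del: real_sqrt_eq_zero_cancel_iff)
  have R'_adj: "(R' *v x) \<bullet> y = x \<bullet> (R' *v y)" for x y
    by (simp add: inner_vec_def R'_def diagonal_matrix_vector_mult algebra_simps)
  have RL: "R *v (L *v x) = R' *v (C *v x)" for x
  proof -
    have "sqrt (\<upsilon> u) * (a / \<upsilon> u) = inverse (sqrt (\<upsilon> u)) * a" for u a
      using nz[of u] pos[of u] real_sqrt_mult_self[of "\<upsilon> u"] by (simp add: field_simps)
    then show ?thesis
      by (simp add: vec_eq_iff R_def R'_def diagonal_matrix_vector_mult L_def C_def
          weighted_Laplacian_mult[where \<upsilon> = \<upsilon>, OF pos])
  qed
  have conj: "T (R *v x) = R *v (L *v x)" for x
    by (simp add: T_def R'R RL)
  have eig: "eigenvalue L \<mu> \<longleftrightarrow> (\<exists>y. y \<noteq> 0 \<and> T y = \<mu> *\<^sub>R y)" for \<mu>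
  proof
    assume "eigenvalue L \<mu>"
    then obtain x where x: "x \<noteq> 0" "L *v x = \<mu> *\<^sub>R x" by (auto simp: eigenvalue_def)
    have "R *v x \<noteq> 0" using x(1) R'R[of x] by force
    moreover have "T (R *v x) = \<mu> *\<^sub>R (R *v x)"
      by (simp add: conj x(2) matrix_vector_mult_scaleR)
    ultimately show "\<exists>y. y \<noteq> 0 \<and> T y = \<mu> *\<^sub>R y" by blast
  next
    assume "\<exists>y. y \<noteq> 0 \<and> T y = \<mu> *\<^sub>R y"
    then obtain y where y: "y \<noteq> 0" "T y = \<mu> *\<^sub>R y" by blast
    have "R' *v y \<noteq> 0" using y(1) RR'[of y] by force
    moreover have "L *v (R' *v y) = \<mu> *\<^sub>R (R' *v y)"
    proof -
      have "R *v (L *v (R' *v y)) = \<mu> *\<^sub>R y"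
        using conj[of "R' *v y"] by (simp add: RR' y(2))
      then show ?thesis
        using R'R[of "L *v (R' *v y)"] by (simp add: matrix_vector_mult_scaleR)
    qed
    ultimately show "eigenvalue L \<mu>" by (auto simp: eigenvalue_def)
  qed
  have lin: "linear T"
    unfolding T_def by (intro linearI) (simp_all add: matrix_vector_right_distrib matrix_vector_mult_scaleR)
  have adj: "T x \<bullet> y = x \<bullet> T y" for x y
    by (simp add: T_def R'_adj C_def combinatorial_Laplacian_selfadjoint)
  have fin: "finite {\<mu>. eigenvalue L \<mu>}"
    unfolding eig using adj by (rule finite_eigenvalues_selfadjoint)
  obtain \<mu> z where "z \<noteq> 0" "T z = \<mu> *\<^sub>R z" and bound: "\<And>y. y \<bullet> T y \<le> \<mu> * (y \<bullet> y)"
    by (rule selfadjoint_maximal_eigenvalue[OF lin adj]) (rule that)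
  then have "eigenvalue L \<mu>" using eig by blast
  then have "\<mu> \<le> largest_eigenvalue L"
    unfolding largest_eigenvalue_def using fin by simp
  then have "\<mu> * ((R *v x) \<bullet> (R *v x)) \<le> largest_eigenvalue L * ((R *v x) \<bullet> (R *v x))"
    by (rule mult_right_mono) simp
  with bound[of "R *v x"]
  have "(R *v x) \<bullet> T (R *v x) \<le> largest_eigenvalue L * ((R *v x) \<bullet> (R *v x))" by linarith
  moreover have "(R *v x) \<bullet> T (R *v x) = x \<bullet> (C *v x)"
    by (simp add: T_def R'R R'_adj[symmetric])
  moreover have "(R *v x) \<bullet> (R *v x) = (\<Sum>v\<in>UNIV. \<upsilon> v * (x $ v)\<^sup>2)"
  proof -
    have "(sqrt (\<upsilon> v) * a) * (sqrt (\<upsilon> v) * a) = \<upsilon> v * a\<^sup>2" for v a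
      using pos[of v] by (simp add: power2_eq_square[symmetric] power_mult_distrib)
    then show ?thesis
      by (simp add: inner_vec_def R_def diagonal_matrix_vector_mult)
  qed
  ultimately show ?thesis by (simp add: C_def L_def)
qed

section \<open>The ratio bound\<close>

lemma combinatorial_Laplacian_mult_const:
  "combinatorial_Laplacian E ends \<epsilon> *v (\<chi> v. c) = 0"
proof -
  have "(combinatorial_Laplacian E ends \<epsilon> *v (\<chi> v. c)) $ u = 0" for u
    unfolding combinatorial_Laplacian_def matrix_vector_mult_diff_rdistrib
      vector_minus_component diagonal_matrix_vector_mult
    by (simp add: adjacency_matrix_def matrix_vector_mult_def weighted_degree_def sum_distrib_right)
  then show ?thesis by (simp add: vec_eq_iff)
qed

lemma Laplacian_form_indicator:
  fixes x :: "real^'v::finite" and T :: "'v set"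
  defines "x \<equiv> (\<chi> v. indicator T v)"
  shows "x \<bullet> (combinatorial_Laplacian E ends \<epsilon> *v x)
    = sum (weighted_degree E ends \<epsilon>) T - (\<Sum>u\<in>T. \<Sum>v\<in>T. total_weight E ends \<epsilon> u v)"
proof -
  have "(combinatorial_Laplacian E ends \<epsilon> *v x) $ u
      = weighted_degree E ends \<epsilon> u * indicator T u - (\<Sum>v\<in>T. total_weight E ends \<epsilon> u v)" for u
    unfolding combinatorial_Laplacian_def matrix_vector_mult_diff_rdistrib
      vector_minus_component diagonal_matrix_vector_mult
    by (simp add: x_def adjacency_matrix_def matrix_vector_mult_def indicator_def
        if_distrib[of "\<lambda>y. _ * y"] sum.If_cases cong: if_cong)
  then have "x \<bullet> (combinatorial_Laplacian E ends \<epsilon> *v x)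
      = (\<Sum>u\<in>UNIV. if u \<in> T then weighted_degree E ends \<epsilon> u
            - (\<Sum>v\<in>T. total_weight E ends \<epsilon> u v) else 0)"
    unfolding inner_vec_def by (intro sum.cong) (auto simp: x_def)
  then show ?thesis by (simp add: sum.If_cases sum_subtractf)
qed

text \<open>
  The shift of the indicator by its weighted mean \<open>c = \<upsilon>(T) / \<upsilon>(V)\<close> has the same Laplacian form and
  the smallest possible weighted norm among all shifts.
\<close>

lemma Laplacian_form_indicator_le:
  fixes x :: "real^'v::finite" and \<upsilon> :: "'v \<Rightarrow> real" and T :: "'v set"
  defines "x \<equiv> (\<chi> v. indicator T v)"
  assumes pos: "\<And>v. 0 < \<upsilon> v"
  shows "x \<bullet> (combinatorial_Laplacian E ends \<epsilon> *v x)
    \<le> largest_eigenvalue (weighted_Laplacian E ends \<upsilon> \<epsilon>)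
        * (sum \<upsilon> T * (1 - sum \<upsilon> T / sum \<upsilon> UNIV))"
proof -
  define c where "c = sum \<upsilon> T / sum \<upsilon> UNIV"
  let ?c = "(\<chi> v. c) :: real^'v"
  let ?C = "combinatorial_Laplacian E ends \<epsilon>"
  have V: "0 < sum \<upsilon> UNIV" using pos by (simp add: sum_pos)
  have c0: "?C *v ?c = 0" by (rule combinatorial_Laplacian_mult_const)
  then have "(x - ?c) \<bullet> (?C *v (x - ?c)) = x \<bullet> (?C *v x)"
    using combinatorial_Laplacian_selfadjoint[of E ends \<epsilon> ?c x]
    by (simp add: matrix_vector_mult_diff_distrib inner_diff_left)
  moreover have "(\<Sum>v\<in>UNIV. \<upsilon> v * ((x - ?c) $ v)\<^sup>2) = sum \<upsilon> T * (1 - c)"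
  proof -
    have "\<upsilon> v * ((x - ?c) $ v)\<^sup>2 = (1 - 2 * c) * (if v \<in> T then \<upsilon> v else 0) + c\<^sup>2 * \<upsilon> v" for v
      by (simp add: x_def indicator_def power2_eq_square algebra_simps)
    then have "(\<Sum>v\<in>UNIV. \<upsilon> v * ((x - ?c) $ v)\<^sup>2)
        = (1 - 2 * c) * sum \<upsilon> T + c\<^sup>2 * sum \<upsilon> UNIV"
      by (simp add: sum.distrib sum_distrib_left[symmetric] sum.If_cases)
    also have "c\<^sup>2 * sum \<upsilon> UNIV = c * sum \<upsilon> T"
      using V by (simp add: c_def power2_eq_square)
    finally show ?thesis by (simp add: algebra_simps)
  qed
  ultimately show ?thesis
    using Laplacian_form_le[where \<upsilon> = \<upsilon>, OF pos, of "x - ?c" E ends \<epsilon>] by (simp add: c_def)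
qed

text \<open>
  At an endpoint of a nonloop edge, the Laplacian form of the indicator is the degree without its
  loop part, hence positive.
\<close>

lemma largest_eigenvalue_weighted_Laplacian_pos:
  fixes ends :: "'e \<Rightarrow> 'v::finite uprod"
  assumes G: "weighted_multigraph E ends \<upsilon> \<epsilon>" and e: "\<exists>e\<in>E. proper_uprod (ends e)"
  shows "0 < largest_eigenvalue (weighted_Laplacian E ends \<upsilon> \<epsilon>)"
proof -
  have fin: "finite E" and pos: "\<And>v. 0 < \<upsilon> v" and epos: "\<And>e. e \<in> E \<Longrightarrow> 0 < \<epsilon> e"
    using G by (auto simp: weighted_multigraph_def)
  obtain e where eE: "e \<in> E" and "proper_uprod (ends e)" using e by blast
  then obtain u w where uw: "ends e = Upair u w" "u \<noteq> w"
    by (cases "ends e") auto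
  have nonneg: "0 \<le> total_weight E ends \<epsilon> a b" for a b
    using epos by (fastforce simp: total_weight_def intro: sum_nonneg less_imp_le)
  have "0 < total_weight E ends \<epsilon> u w"
    unfolding total_weight_def using fin epos eE uw by (auto intro!: sum_pos)
  then have "0 < (\<Sum>v\<in>UNIV - {u}. total_weight E ends \<epsilon> u v)"
    using uw(2) nonneg by (intro sum_pos2[of _ w]) auto
  also have "\<dots> = weighted_degree E ends \<epsilon> u - total_weight E ends \<epsilon> u u"
    by (simp add: weighted_degree_def sum_diff1)
  also have "\<dots> = (\<chi> v. indicator {u} v) \<bullet>
      (combinatorial_Laplacian E ends \<epsilon> *v (\<chi> v. indicator {u} v))"
    unfolding Laplacian_form_indicator by simp
  also have "\<dots> \<le> largest_eigenvalue (weighted_Laplacian E ends \<upsilon> \<epsilon>)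
      * (\<Sum>v\<in>UNIV. \<upsilon> v * ((\<chi> v. indicator {u} v) $ v)\<^sup>2)" (is "_ \<le> _ * ?N")
    by (rule Laplacian_form_le[where \<upsilon> = \<upsilon>, OF pos])
  finally have "0 < largest_eigenvalue (weighted_Laplacian E ends \<upsilon> \<epsilon>) * ?N" .
  moreover have "0 \<le> ?N"
    using pos by (intro sum_nonneg mult_nonneg_nonneg) (simp_all add: less_imp_le)
  ultimately show ?thesis
    by (simp only: zero_less_mult_iff) linarith
qed

theorem theorem7p3:
  fixes E :: "'e set"
    and ends :: "'e \<Rightarrow> 'v::finite uprod"
    and \<upsilon> :: "'v \<Rightarrow> real"
    and \<epsilon> :: "'e \<Rightarrow> real"
    and S :: "'v set"
  defines "lam \<equiv> largest_eigenvalue (weighted_Laplacian E ends \<upsilon> \<epsilon>)"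
  assumes "weighted_multigraph E ends \<upsilon> \<epsilon>"
    and "\<exists>e\<in>E. proper_uprod (ends e)"
    and "S \<noteq> {}"
    and "independent_set E ends S"
  shows "sum \<upsilon> S \<le> sum \<upsilon> UNIV * ((lam - sum (weighted_degree E ends \<epsilon>) S / sum \<upsilon> S) / lam)"
proof -
  have pos: "\<And>v. 0 < \<upsilon> v" using assms(2) by (simp add: weighted_multigraph_def)
  have lam: "0 < lam"
    unfolding lam_def using assms(2,3) by (rule largest_eigenvalue_weighted_Laplacian_pos)
  have s: "0 < sum \<upsilon> S" using pos assms(4) by (simp add: sum_pos)
  have V: "0 < sum \<upsilon> UNIV" using pos by (simp add: sum_pos)
  have no_edge: "total_weight E ends \<epsilon> u v = 0" if "u \<in> S" "v \<in> S" for u v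
  proof -
    have none: "{e \<in> E. ends e = Upair u v} = {}"
      using assms(5) that unfolding independent_set_def by blast
    show ?thesis unfolding total_weight_def none by simp
  qed
  let ?d = "sum (weighted_degree E ends \<epsilon>) S"
  have "?d \<le> lam * (sum \<upsilon> S * (1 - sum \<upsilon> S / sum \<upsilon> UNIV))"
    using Laplacian_form_indicator_le[where \<upsilon> = \<upsilon>, OF pos, of S E ends \<epsilon>]
    unfolding Laplacian_form_indicator lam_def[symmetric] by (simp add: no_edge)
  then have "?d / sum \<upsilon> S \<le> lam * (1 - sum \<upsilon> S / sum \<upsilon> UNIV)"
    using s by (simp add: pos_divide_le_eq mult_ac)
  then have "lam * (sum \<upsilon> S / sum \<upsilon> UNIV) \<le> lam - ?d / sum \<upsilon> S"
    by (simp add: right_diff_distrib)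
  then have "sum \<upsilon> S / sum \<upsilon> UNIV \<le> (lam - ?d / sum \<upsilon> S) / lam"
    using lam by (simp add: pos_le_divide_eq mult.commute)
  then show ?thesis
    using V by (simp add: pos_divide_le_eq mult.commute)
qed

end
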